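(* A competitive equilibrium in the standard two-stage market (without any mitigation policy) exists and is given by the following conditions on the bids $\beta_j^d,\beta_j^r$ ($j\in\mathcal{G}$), load allocations $d_l^d,d_l^r$ ($l\in\mathcal{L}$) and prices $\lambda^d,\lambda^r$: \begin{align*} &\beta_j^d+\beta_j^r=\frac{b^d+b^r-c_j^{-1}}{\sum_{k\in\mathcal{G}}c_k^{-1}}\,d,\quad \forall j\in\mathcal{G},\\ &\sum_{j\in\mathcal{G}}(b^d\lambda^d-\beta_j^d)=\sum_{l\in\mathcal{L}}d_l^d,\qquad \sum_{j\in\mathcal{G}}(b^r\lambda^r-\beta_j^r)=\sum_{l\in\mathcal{L}}d_l^r,\\ &d_l^d+d_l^r=d_l,\quad\forall l\in\mathcal{L},\\ &\lambda^d=\lambda^r=\frac{d}{\sum_{k\in\mathcal{G}}c_k^{-1}}. \end{align*} That is, competitive equilibria exist and are exactly the tuples satisfying these conditions.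
   Context: Market: $\mathcal{G}$ (generators) and $\mathcal{L}$ (loads) are finite nonempty sets. Generator $j$ has cost $\frac{c_j}{2}g_j^2$, $c_j>0$, for total dispatch $g_j=g_j^d+g_j^r$, where $g_j^d,g_j^r\in\mathbb{R}$ are its day-ahead and real-time dispatches. Load $l$ has fixed inelastic demand $d_l>0$ split as $d_l=d_l^d+d_l^r$ with $d_l^d,d_l^r\in\mathbb{R}$ (day-ahead and real-time); $d:=\sum_{l\in\mathcal{L}}d_l$. Intercept-function bids: $b^d,b^r>0$ are fixed slopes. In the day-ahead (resp. real-time) market generator $j$ bids $\beta_j^d\in\mathbb{R}$ (resp. $\beta_j^r\in\mathbb{R}$), which means $g_j^d=b^d\lambda^d-\beta_j^d$ (resp. $g_j^r=b^r\lambda^r-\beta_j^r$) at price $\lambda^d$ (resp. $\lambda^r$). Load $l$ bids the quantity $d_l^d$ day-ahead, and $d_l^r=d_l-d_l^d$. The markets clear when $\sum_j(b^d\lambda^d-\beta_j^d)=\sum_l d_l^d$ and $\sum_j(b^r\lambda^r-\beta_j^r)=\sum_l d_l^r$. Profit of generator $j$: $\pi_j=\lambda^rg_j^r+\lambda^dg_j^d-\frac{c_j}{2}(g_j^d+g_j^r)^2$. Payment of load $l$: $\rho_l=\lambda^dd_l^d+\lambda^r(d_l-d_l^d)$. Competitive equilibrium (price-taking participants): a tuple $(\beta_j^d,\beta_j^r,j\in\mathcal{G};\ d_l^d,d_l^r,l\in\mathcal{L};\ \lambda^d,\lambda^r)$ such that, taking $(\lambda^d,\lambda^r)$ as given, $(\beta_j^d,\beta_j^r)\in\mathbb{R}^2$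 maximizes $\pi_j$ for every $j$, $d_l^d\in\mathbb{R}$ minimizes $\rho_l$ (with $d_l^r=d_l-d_l^d$) for every $l$, and both markets clear. *)

theory Defs
  imports Complex_Main
begin

(* Suffixes d and r stand for day-ahead and real-time; b is a bid slope, p a price. *)

definition dispatch :: "real \<Rightarrow> real \<Rightarrow> real \<Rightarrow> real" where
  "dispatch b p \<beta> = b * p - \<beta>"

definition gen_cost :: "real \<Rightarrow> real \<Rightarrow> real" where
  "gen_cost c g = c / 2 * g\<^sup>2"

definition gen_profit :: "real \<Rightarrow> real \<Rightarrow> real \<Rightarrow> real \<Rightarrow> real \<Rightarrow> real \<Rightarrow> real \<Rightarrow> real" where
  "gen_profit bd br c pd pr \<beta>d \<beta>r =
     pr * dispatch br pr \<beta>r + pd * dispatch bd pd \<beta>d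
       - gen_cost c (dispatch bd pd \<beta>d + dispatch br pr \<beta>r)"

definition load_payment :: "real \<Rightarrow> real \<Rightarrow> real \<Rightarrow> real \<Rightarrow> real" where
  "load_payment dl pd pr dd = pd * dd + pr * (dl - dd)"

definition market_clears ::
  "'g set \<Rightarrow> 'l set \<Rightarrow> real \<Rightarrow> real \<Rightarrow> ('g \<Rightarrow> real) \<Rightarrow> ('l \<Rightarrow> real) \<Rightarrow> bool" where
  "market_clears G L b p \<beta> q \<longleftrightarrow> (\<Sum>j\<in>G. dispatch b p (\<beta> j)) = (\<Sum>l\<in>L. q l)"

(* Participants are price-takers: the deviations x and y range over all of the reals
   while both prices are held fixed. Functions are only constrained on G and L. *)
definition competitive_equilibrium ::
  "'g set \<Rightarrow> 'l set \<Rightarrow> ('g \<Rightarrow> real) \<Rightarrow> ('l \<Rightarrow> real) \<Rightarrow> real \<Rightarrow> real \<Rightarrow>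
   ('g \<Rightarrow> real) \<Rightarrow> ('g \<Rightarrow> real) \<Rightarrow> ('l \<Rightarrow> real) \<Rightarrow> ('l \<Rightarrow> real) \<Rightarrow> real \<Rightarrow> real \<Rightarrow> bool" where
  "competitive_equilibrium G L c dem bd br \<beta>d \<beta>r dd dr pd pr \<longleftrightarrow>
     (\<forall>j\<in>G. \<forall>x y. gen_profit bd br (c j) pd pr x y
                  \<le> gen_profit bd br (c j) pd pr (\<beta>d j) (\<beta>r j)) \<and>
     (\<forall>l\<in>L. \<forall>x. load_payment (dem l) pd pr (dd l) \<le> load_payment (dem l) pd pr x) \<and>
     (\<forall>l\<in>L. dr l = dem l - dd l) \<and>
     market_clears G L bd pd \<beta>d dd \<and>
     market_clears G L br pr \<beta>r dr"

end

theory Submission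
  imports Defs
begin

text \<open>Every load can shift demand between the two stages without limit, so optimality for a load
  forces equal prices. At a common price \<open>p\<close> only the total dispatch of a generator matters, and
  completing the square shows that it must be \<open>p / c\<close>. Adding the two clearing conditions then
  determines \<open>p\<close>.\<close>

text \<open>The payment is affine in the day-ahead quantity with slope \<open>pd - pr\<close>, so
  over all reals it has a minimum only if the slope vanishes, and then every quantity is
  optimal.\<close>

lemma load_optimal_iff:
  "(\<forall>x. load_payment m pd pr q \<le> load_payment m pd pr x) \<longleftrightarrow> pd = pr"
proof
  assume opt: "\<forall>x. load_payment m pd pr q \<le> load_payment m pd pr x"
  \<comment> \<open>Moving against the slope by \<open>pd - pr\<close> lowers the payment by exactly
    \<open>(pd - pr)\<^sup>2\<close>.\<close>
  have "(pd - pr)\<^sup>2 \<le> 0"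
    using opt[rule_format, of "q - (pd - pr)"]
    by (simp add: load_payment_def power2_eq_square algebra_simps)
  then show "pd = pr" by simp
qed (simp add: load_payment_def algebra_simps)

text \<open>With total dispatch \<open>g = (bd + br) * p - (x + y)\<close>, the profit is
  \<open>p * g - c / 2 * g\<^sup>2\<close>; the square is completed around
  \<open>g = p / c\<close>.\<close>

lemma gen_profit_equal_prices:
  assumes "c \<noteq> 0"
  shows "gen_profit bd br c p p x y =
    p\<^sup>2 / (2 * c) - c / 2 * (x + y - (bd + br - inverse c) * p)\<^sup>2"
  using assms
  by (simp add: gen_profit_def gen_cost_def dispatch_def power2_eq_square field_simps)

lemma gen_optimal_iff:
  assumes "c > 0"
  shows "(\<forall>x y. gen_profit bd br c p p x y \<le> gen_profit bd br c p p u v) \<longleftrightarrow>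
    u + v = (bd + br - inverse c) * p"
proof
  assume opt: "\<forall>x y. gen_profit bd br c p p x y \<le> gen_profit bd br c p p u v"
  \<comment> \<open>Only the sum of the two bids matters, so the deviation puts the whole optimal
    sum into the day-ahead bid; it makes the square vanish.\<close>
  have "c / 2 * (u + v - (bd + br - inverse c) * p)\<^sup>2 \<le> 0"
    using opt[rule_format, of "(bd + br - inverse c) * p" 0] assms
    by (simp add: gen_profit_equal_prices)
  with assms show "u + v = (bd + br - inverse c) * p"
    by (simp add: mult_le_0_iff)
qed (use assms in \<open>simp add: gen_profit_equal_prices\<close>)

lemma competitive_equilibrium_iff:
  assumes "L \<noteq> {}" and "\<forall>j\<in>G. c j > 0"
  shows "competitive_equilibrium G L c dem bd br \<beta>d \<beta>r dd dr pd pr \<longleftrightarrow>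
    pd = pr \<and> (\<forall>j\<in>G. \<beta>d j + \<beta>r j = (bd + br - inverse (c j)) * pr) \<and>
    (\<forall>l\<in>L. dd l + dr l = dem l) \<and>
    (\<Sum>j\<in>G. bd * pd - \<beta>d j) = (\<Sum>l\<in>L. dd l) \<and>
    (\<Sum>j\<in>G. br * pr - \<beta>r j) = (\<Sum>l\<in>L. dr l)"
proof -
  have "(\<forall>l\<in>L. dr l = dem l - dd l) \<longleftrightarrow> (\<forall>l\<in>L. dd l + dr l = dem l)"
    by (auto simp: algebra_simps)
  moreover have "(\<forall>l\<in>L. \<forall>x. load_payment (dem l) pd pr (dd l) \<le> load_payment (dem l) pd pr x)
      \<longleftrightarrow> pd = pr"
    using assms(1) by (auto simp: load_optimal_iff)
  \<comment> \<open>Both prices are written \<open>pr\<close> here: the load condition already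
    forces \<open>pd = pr\<close>.\<close>
  moreover have "(\<forall>j\<in>G. \<forall>x y. gen_profit bd br (c j) pr pr x y
        \<le> gen_profit bd br (c j) pr pr (\<beta>d j) (\<beta>r j))
      \<longleftrightarrow> (\<forall>j\<in>G. \<beta>d j + \<beta>r j = (bd + br - inverse (c j)) * pr)"
    using assms(2) by (simp add: gen_optimal_iff)
  ultimately show ?thesis
    unfolding competitive_equilibrium_def market_clears_def dispatch_def by auto
qed

text \<open>When the two clearing conditions are added, the bid slopes cancel: each generator
  supplies \<open>p * inverse (c j)\<close> in total, and these amounts must add up to the total
  demand.\<close>

lemma clearing_price:
  fixes c :: "'g \<Rightarrow> real"
  assumes "(\<Sum>k\<in>G. inverse (c k)) \<noteq> 0"
    and bids: "\<forall>j\<in>G. \<beta>d j + \<beta>r j = (bd + br - inverse (c j)) * p"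
    and dem: "\<forall>l\<in>L. dd l + dr l = dem l"
    and clear: "(\<Sum>j\<in>G. bd * p - \<beta>d j) = (\<Sum>l\<in>L. dd l)"
      "(\<Sum>j\<in>G. br * p - \<beta>r j) = (\<Sum>l\<in>L. dr l)"
  shows "p = (\<Sum>l\<in>L. dem l) / (\<Sum>k\<in>G. inverse (c k))"
proof -
  have "(\<Sum>l\<in>L. dem l) = (\<Sum>l\<in>L. dd l) + (\<Sum>l\<in>L. dr l)"
    using dem by (simp flip: sum.distrib)
  also have "\<dots> = (\<Sum>j\<in>G. (bd * p - \<beta>d j) + (br * p - \<beta>r j))"
    using clear by (simp only: sum.distrib)
  also have "\<dots> = (\<Sum>j\<in>G. p * inverse (c j))"
  proof (rule sum.cong)
    fix j assume "j \<in> G"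
    with bids have "\<beta>d j + \<beta>r j = (bd + br - inverse (c j)) * p" by blast
    then show "(bd * p - \<beta>d j) + (br * p - \<beta>r j) = p * inverse (c j)"
      by (simp add: algebra_simps)
  qed simp
  also have "\<dots> = p * (\<Sum>k\<in>G. inverse (c k))"
    by (simp add: sum_distrib_left)
  finally show ?thesis using assms(1) by simp
qed

theorem theorem1:
  fixes G :: "'g set" and L :: "'l set"
    and c :: "'g \<Rightarrow> real" and dem :: "'l \<Rightarrow> real" and bd br :: real
  assumes "finite G" and "G \<noteq> {}" and "finite L" and "L \<noteq> {}"
    and "\<And>j. j \<in> G \<Longrightarrow> c j > 0" and "\<And>l. l \<in> L \<Longrightarrow> dem l > 0"
    and "bd > 0" and "br > 0"
  shows "(\<exists>\<beta>d \<beta>r dd dr pd pr.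
            competitive_equilibrium G L c dem bd br \<beta>d \<beta>r dd dr pd pr) \<and>
         (\<forall>\<beta>d \<beta>r dd dr pd pr.
            competitive_equilibrium G L c dem bd br \<beta>d \<beta>r dd dr pd pr \<longleftrightarrow>
              (\<forall>j\<in>G. \<beta>d j + \<beta>r j =
                 (bd + br - inverse (c j)) / (\<Sum>k\<in>G. inverse (c k)) * (\<Sum>l\<in>L. dem l)) \<and>
              (\<Sum>j\<in>G. bd * pd - \<beta>d j) = (\<Sum>l\<in>L. dd l) \<and>
              (\<Sum>j\<in>G. br * pr - \<beta>r j) = (\<Sum>l\<in>L. dr l) \<and>
              (\<forall>l\<in>L. dd l + dr l = dem l) \<and>
              pd = pr \<and>
              pr = (\<Sum>l\<in>L. dem l) / (\<Sum>k\<in>G. inverse (c k)))"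
proof -
  let ?S = "\<Sum>k\<in>G. inverse (c k)" and ?D = "\<Sum>l\<in>L. dem l"
  let ?p = "?D / ?S"
  have S: "?S \<noteq> 0"
    using sum_pos[of G "\<lambda>k. inverse (c k)"] assms by force
  have "\<forall>j\<in>G. c j > 0" using assms(5) by blast
  note eq_iff = competitive_equilibrium_iff[OF assms(4) this]
  \<comment> \<open>The whole demand is served day-ahead.\<close>
  have "competitive_equilibrium G L c dem bd br
      (\<lambda>j. bd * p - p * inverse (c j)) (\<lambda>j. br * p) dem (\<lambda>l. 0) p p" if "p * ?S = ?D" for p
    using that by (simp add: eq_iff algebra_simps sum_distrib_left)
  \<comment> \<open>The witness was verified for any \<open>p\<close> with
    \<open>p * ?S = ?D\<close>, which keeps the quotient \<open>?p\<close> out of the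
    simplification; \<open>?S \<noteq> 0\<close> makes \<open>?p\<close> such a price.\<close>
  from this[of ?p] have "\<exists>\<beta>d \<beta>r dd dr pd pr.
      competitive_equilibrium G L c dem bd br \<beta>d \<beta>r dd dr pd pr"
    using S by (metis nonzero_eq_divide_eq)
  moreover have "competitive_equilibrium G L c dem bd br \<beta>d \<beta>r dd dr pd pr \<longleftrightarrow>
      (\<forall>j\<in>G. \<beta>d j + \<beta>r j = (bd + br - inverse (c j)) / ?S * ?D) \<and>
      (\<Sum>j\<in>G. bd * pd - \<beta>d j) = (\<Sum>l\<in>L. dd l) \<and>
      (\<Sum>j\<in>G. br * pr - \<beta>r j) = (\<Sum>l\<in>L. dr l) \<and>
      (\<forall>l\<in>L. dd l + dr l = dem l) \<and> pd = pr \<and> pr = ?p" for \<beta>d \<beta>r dd dr pd pr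
  proof -
    have "(bd + br - inverse (c j)) / ?S * ?D = (bd + br - inverse (c j)) * ?p" for j
      by simp
    then show ?thesis
      \<comment> \<open>From left to right, \<open>clearing_price\<close> identifies
        \<open>pr\<close> with \<open>?p\<close>; from right to left, the given price is substituted
        into the bid condition.\<close>
      unfolding eq_iff using clearing_price[OF S, of \<beta>d \<beta>r bd br pr L dd dr dem] by auto
  qed
  ultimately show ?thesis by blast
qed

end
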